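(* Let $\sigma$ be a complex polynomial of degree $\le2$, $\sigma\neq0$, $\kappa$ a complex polynomial of degree $\le1$, and $\rho$ a nonzero solution of $(\sigma(z)\partial_z-\kappa(z))\rho(z)=0$. For $n=0,1,2,\dots$ set $$\kappa_{-n}(z):=\kappa(z)-n\sigma'(z),\qquad \omega_{-n}:=-(n+\tfrac12)\kappa'+n^2\frac{\sigma''}{2}=-\kappa_{-n}'(n+\tfrac12)-n(n+1)\frac{\sigma''}{2}.$$ Then the polynomials $P_n(\sigma,\kappa_{-n};z)$ satisfy the equation $$\big(\mathcal{H}(\sigma,\kappa_{-n})+\omega_{-n}\big)P_n(\sigma,\kappa_{-n};z)=0,$$ the recurrence relations $$\big(\sigma(z)\partial_z+\kappa_{-n}(z)\big)P_n(\sigma,\kappa_{-n};z)=(n+1)P_{n+1}(\sigma,\kappa_{-n-1};z),$$ $$\partial_zP_{n+1}(\sigma,\kappa_{-n-1};z)=\Big(n\frac{\sigma''}{2}+\kappa_{-n}'\Big)P_n(\sigma,\kappa_{-n};z),$$ and have the generating function $$\frac{\rho(z+t\sigma(z))}{\rho(z)}=\sum_{n=0}^\infty t^nP_n(\sigma,\kappa_{-n};z).$$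
   Context: $\mathcal{H}(\sigma,\kappa):=\sigma(z)\partial_z^2+(\sigma'(z)+\kappa(z))\partial_z+\frac12\kappa'$. For polynomials $\sigma$ ($\deg\le2$), $\tilde\kappa$ ($\deg\le1$) and $n\in\{0,1,2,\dots\}$, $$P_n(\sigma,\tilde\kappa;z):=\frac{1}{n!}\tilde\rho^{-1}(z)\,\partial_z^n\big(\sigma^n(z)\tilde\rho(z)\big),$$ where $\tilde\rho$ is any nonzero solution of $\sigma\tilde\rho'=\tilde\kappa\tilde\rho$ (the result does not depend on the choice and is a polynomial in $z$ of degree $\le n$). The generating function identity is for $z$ with $\sigma(z)\ne0$ and $|t|$ small enough that $z+t\sigma(z)$ lies in a disc around $z$ free of zeros of $\sigma$, on which a branch of $\rho$ is fixed. *)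

theory Defs
  imports "HOL-Complex_Analysis.Complex_Analysis"
begin

text \<open>
  A nonzero solution of \<open>\<sigma> \<rho>' = \<kappa> \<rho>\<close> is in general multivalued on the complement of the
  zeros of \<open>\<sigma>\<close>; here \<open>\<rho>\<close> is a single-valued holomorphic branch of it on a region \<open>U\<close>
  without zeros of \<open>\<sigma>\<close>. \<open>Nonzero\<close> means not identically zero.
\<close>

definition pearson_solution ::
  "complex poly \<Rightarrow> complex poly \<Rightarrow> complex set \<Rightarrow> (complex \<Rightarrow> complex) \<Rightarrow> bool" where
  "pearson_solution \<sigma> \<kappa> U \<rho> \<longleftrightarrow>
     open U \<and> connected U \<and> (\<forall>z\<in>U. poly \<sigma> z \<noteq> 0) \<and>
     \<rho> holomorphic_on U \<and> (\<exists>z\<in>U. \<rho> z \<noteq> 0) \<and>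
     (\<forall>z\<in>U. poly \<sigma> z * deriv \<rho> z = poly \<kappa> z * \<rho> z)"

text \<open>
  The Rodrigues formula for \<open>P\<^sub>n(\<sigma>, \<kappa>; z)\<close>. The description operator picks the polynomial
  given by the formula for every branch of every nonzero solution; for \<open>\<sigma> \<noteq> 0\<close> there is
  exactly one such polynomial, see \<open>rodrigues_poly_ex1\<close> below.
\<close>

definition rodrigues_poly :: "nat \<Rightarrow> complex poly \<Rightarrow> complex poly \<Rightarrow> complex poly" where
  "rodrigues_poly n \<sigma> \<kappa> =
     (THE p. \<forall>U \<rho>. pearson_solution \<sigma> \<kappa> U \<rho> \<longrightarrow>
        (\<forall>z\<in>U. poly p z =
           1 / fact n * inverse (\<rho> z) * (deriv ^^ n) (\<lambda>w. poly \<sigma> w ^ n * \<rho> w) z))"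

text \<open>The operator \<open>\<H>(\<sigma>,\<kappa>) = \<sigma> \<partial>\<^sup>2 + (\<sigma>' + \<kappa>) \<partial> + \<kappa>'/2\<close>, acting on polynomials.\<close>

definition hyp_op :: "complex poly \<Rightarrow> complex poly \<Rightarrow> complex poly \<Rightarrow> complex poly" where
  "hyp_op \<sigma> \<kappa> p =
     \<sigma> * pderiv (pderiv p) + (pderiv \<sigma> + \<kappa>) * pderiv p + smult (1/2) (pderiv \<kappa>) * p"

definition kappa_minus :: "complex poly \<Rightarrow> complex poly \<Rightarrow> nat \<Rightarrow> complex poly" where
  "kappa_minus \<sigma> \<kappa> n = \<kappa> - smult (of_nat n) (pderiv \<sigma>)"

text \<open>
  \<open>\<kappa>'\<close> and \<open>\<sigma>''\<close> are constants under the degree bounds on \<open>\<kappa>\<close> and \<open>\<sigma>\<close>, and they are kept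
  as (constant) polynomials.
\<close>

definition omega_minus :: "complex poly \<Rightarrow> complex poly \<Rightarrow> nat \<Rightarrow> complex poly" where
  "omega_minus \<sigma> \<kappa> n =
     - smult (of_nat n + 1/2) (pderiv \<kappa>) + smult (of_nat n ^ 2 / 2) (pderiv (pderiv \<sigma>))"


lemma pearson_solution_local:
  assumes "poly \<sigma> z \<noteq> 0"
  obtains r \<rho> where "r > 0" "pearson_solution \<sigma> \<kappa> (ball z r) \<rho>"
    "\<And>w. w \<in> ball z r \<Longrightarrow> \<rho> w \<noteq> 0"
proof -
  have "open {w. poly \<sigma> w \<noteq> 0}"
    by (intro open_Collect_neq continuous_intros)
  then obtain r where r: "r > 0" "ball z r \<subseteq> {w. poly \<sigma> w \<noteq> 0}"
    using assms openE by blast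
  have "(\<lambda>w. poly \<kappa> w / poly \<sigma> w) holomorphic_on ball z r"
    using r by (intro holomorphic_intros) auto
  then obtain h where h:
    "\<And>w. w \<in> ball z r \<Longrightarrow> (h has_field_derivative poly \<kappa> w / poly \<sigma> w) (at w within ball z r)"
    using holomorphic_convex_primitive'[of "ball z r" "\<lambda>w. poly \<kappa> w / poly \<sigma> w"]
    by auto
  have h': "((\<lambda>w. exp (h w)) has_field_derivative exp (h w) * (poly \<kappa> w / poly \<sigma> w)) (at w)"
    if "w \<in> ball z r" for w
    using h[OF that] that by (auto intro!: derivative_eq_intros simp: at_within_open[OF that])
  have "pearson_solution \<sigma> \<kappa> (ball z r) (\<lambda>w. exp (h w))"
    unfolding pearson_solution_def
  proof (intro conjI ballI)
    show "(\<lambda>w. exp (h w)) holomorphic_on ball z r"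
      unfolding holomorphic_on_open[OF open_ball] using h' by blast
    show "\<exists>w\<in>ball z r. exp (h w) \<noteq> 0"
      using r by (intro bexI[of _ z]) auto
    fix w assume w: "w \<in> ball z r"
    show "poly \<sigma> w * deriv (\<lambda>w. exp (h w)) w = poly \<kappa> w * exp (h w)"
      using DERIV_imp_deriv[OF h'[OF w]] r w by auto
  qed (use r in auto)
  with r show ?thesis using that by simp
qed

lemma pearson_solution_nonzero:
  assumes sol: "pearson_solution \<sigma> \<kappa> U \<rho>" and a: "a \<in> U"
  shows "\<rho> a \<noteq> 0"
proof
  assume 0: "\<rho> a = 0"
  note S = sol[unfolded pearson_solution_def]
  obtain r h where r: "r > 0" and h: "pearson_solution \<sigma> \<kappa> (ball a r) h"
    and hnz: "\<And>w. w \<in> ball a r \<Longrightarrow> h w \<noteq> 0"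
    using pearson_solution_local S a by metis
  note H = h[unfolded pearson_solution_def]
  obtain e where e: "e > 0" "ball a e \<subseteq> U"
    using S a openE by blast
  define d where "d = min r e"
  have d: "d > 0" "ball a d \<subseteq> U" "ball a d \<subseteq> ball a r"
    using r e by (auto simp: d_def)
  have der: "((\<lambda>w. \<rho> w / h w) has_field_derivative 0) (at w)" if w: "w \<in> ball a d" for w
  proof -
    have wU: "w \<in> U" and wr: "w \<in> ball a r" using w d by auto
    have 1: "(\<rho> has_field_derivative deriv \<rho> w) (at w)"
      using S wU holomorphic_derivI by blast
    have 2: "(h has_field_derivative deriv h w) (at w)"
      using H wr holomorphic_derivI by blast
    have "poly \<sigma> w * (deriv \<rho> w * h w - \<rho> w * deriv h w) =
          (poly \<sigma> w * deriv \<rho> w) * h w - \<rho> w * (poly \<sigma> w * deriv h w)"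
      by (simp add: algebra_simps)
    also have "\<dots> = (poly \<kappa> w * \<rho> w) * h w - \<rho> w * (poly \<kappa> w * h w)"
      using S H wU wr by simp
    finally have "deriv \<rho> w * h w - \<rho> w * deriv h w = 0"
      using S wU by simp
    then show ?thesis
      using DERIV_divide[OF 1 2] hnz[OF wr] by simp
  qed
  obtain c where c: "\<And>w. w \<in> ball a d \<Longrightarrow> \<rho> w / h w = c"
    using has_field_derivative_zero_constant[of "ball a d" "\<lambda>w. \<rho> w / h w"] der
    by (metis convex_ball has_field_derivative_at_within)
  have "c = 0" using c[of a] 0 d by simp
  then have z: "\<rho> w = 0" if "w \<in> ball a d" for w
    using c[OF that] hnz that d by auto
  have "\<rho> w = 0" if "w \<in> U" for w
    using analytic_continuation_open[of "ball a d" U \<rho> "\<lambda>_. 0" w] S d z that by auto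
  then show False using S by auto
qed

fun rodrigues_aux :: "complex poly \<Rightarrow> complex poly \<Rightarrow> nat \<Rightarrow> nat \<Rightarrow> complex poly" where
  "rodrigues_aux \<sigma> \<kappa> n 0 = 1"
| "rodrigues_aux \<sigma> \<kappa> n (Suc k) =
     (smult (of_nat (n - k)) (pderiv \<sigma>) + \<kappa>) * rodrigues_aux \<sigma> \<kappa> n k
     + \<sigma> * pderiv (rodrigues_aux \<sigma> \<kappa> n k)"

lemma degree_rodrigues_aux:
  assumes "degree \<sigma> \<le> 2" "degree \<kappa> \<le> 1"
  shows "degree (rodrigues_aux \<sigma> \<kappa> n k) \<le> k"
proof (induction k)
  case (Suc k)
  let ?q = "rodrigues_aux \<sigma> \<kappa> n k"
  have "degree (smult (of_nat (n - k)) (pderiv \<sigma>) + \<kappa>) \<le> 1"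
    using assms by (intro degree_add_le order.trans[OF degree_smult_le]) (auto simp: degree_pderiv)
  then have 1: "degree ((smult (of_nat (n - k)) (pderiv \<sigma>) + \<kappa>) * ?q) \<le> Suc k"
    using degree_mult_le[of "smult (of_nat (n - k)) (pderiv \<sigma>) + \<kappa>" ?q] Suc by linarith
  have 2: "degree (\<sigma> * pderiv ?q) \<le> Suc k"
  proof (cases "degree ?q = 0")
    case True
    then obtain c where "?q = [:c:]" by (rule degree_eq_zeroE)
    then show ?thesis by (simp add: pderiv_pCons)
  next
    case False
    then show ?thesis
      using degree_mult_le[of \<sigma> "pderiv ?q"] Suc assms by (simp add: degree_pderiv)
  qed
  show ?case using 1 2 by (simp add: degree_add_le)
qed simp

lemma higher_deriv_rodrigues:
  assumes sol: "pearson_solution \<sigma> \<kappa> U \<rho>" and "k \<le> n" and "z \<in> U"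
  shows "(deriv ^^ k) (\<lambda>w. poly \<sigma> w ^ n * \<rho> w) z =
         poly (\<sigma> ^ (n - k) * rodrigues_aux \<sigma> \<kappa> n k) z * \<rho> z"
  using assms(2,3)
proof (induction k arbitrary: z)
  case (Suc k)
  note S = sol[unfolded pearson_solution_def]
  obtain m where m: "n - k = Suc m" "n - Suc k = m"
    using Suc.prems by (metis Suc_diff_Suc Suc_le_lessD)
  let ?q = "rodrigues_aux \<sigma> \<kappa> n k"
  let ?g = "\<lambda>w. poly (\<sigma> ^ Suc m * ?q) w * \<rho> w"
  have "(\<rho> has_field_derivative deriv \<rho> z) (at z)"
    using S Suc.prems holomorphic_derivI by blast
  then have "(?g has_field_derivative
      (poly (pderiv (\<sigma> ^ Suc m * ?q)) z * \<rho> z + deriv \<rho> z * poly (\<sigma> ^ Suc m * ?q) z)) (at z)"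
    by (intro DERIV_mult poly_DERIV)
  then have "((deriv ^^ k) (\<lambda>w. poly \<sigma> w ^ n * \<rho> w) has_field_derivative
      (poly (pderiv (\<sigma> ^ Suc m * ?q)) z * \<rho> z + deriv \<rho> z * poly (\<sigma> ^ Suc m * ?q) z)) (at z)"
  proof (rule has_field_derivative_transform_within_open[of _ _ _ U])
    show "?g w = (deriv ^^ k) (\<lambda>w. poly \<sigma> w ^ n * \<rho> w) w" if "w \<in> U" for w
      using Suc.IH[of w] Suc.prems that m by simp
  qed (use S Suc.prems in auto)
  then have "(deriv ^^ Suc k) (\<lambda>w. poly \<sigma> w ^ n * \<rho> w) z =
      poly (pderiv (\<sigma> ^ Suc m * ?q)) z * \<rho> z + deriv \<rho> z * poly (\<sigma> ^ Suc m * ?q) z"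
    using DERIV_imp_deriv by simp
  also have "deriv \<rho> z * poly (\<sigma> ^ Suc m * ?q) z =
      (poly \<sigma> z * deriv \<rho> z) * poly (\<sigma> ^ m * ?q) z"
    by simp
  also have "poly \<sigma> z * deriv \<rho> z = poly \<kappa> z * \<rho> z"
    using S Suc.prems by blast
  also have "pderiv (\<sigma> ^ Suc m * ?q) =
      \<sigma> ^ Suc m * pderiv ?q + ?q * (smult (of_nat (Suc m)) (\<sigma> ^ m) * pderiv \<sigma>)"
    by (simp only: pderiv_mult pderiv_power_Suc)
  finally show ?case
    by (simp add: m algebra_simps del: of_nat_Suc)
qed simp

lemma rodrigues_poly_aux:
  fixes \<sigma> \<kappa> :: "complex poly" and n :: nat
  assumes "\<sigma> \<noteq> 0"
  defines "P \<equiv> \<lambda>p. \<forall>U \<rho>. pearson_solution \<sigma> \<kappa> U \<rho> \<longrightarrow>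
     (\<forall>z\<in>U. poly p z =
        1 / fact n * inverse (\<rho> z) * (deriv ^^ n) (\<lambda>w. poly \<sigma> w ^ n * \<rho> w) z)"
  shows "P (smult (1 / fact n) (rodrigues_aux \<sigma> \<kappa> n n))"
    and "P p \<Longrightarrow> P q \<Longrightarrow> p = q"
proof -
  show "P (smult (1 / fact n) (rodrigues_aux \<sigma> \<kappa> n n))"
    unfolding P_def using higher_deriv_rodrigues pearson_solution_nonzero
    by (auto simp: field_simps)
  assume pq: "P p" "P q"
  obtain z where "poly \<sigma> z \<noteq> 0"
    using assms poly_all_0_iff_0 by blast
  then obtain r \<rho> where r: "r > 0" "pearson_solution \<sigma> \<kappa> (ball z r) \<rho>"
    using pearson_solution_local by metis
  then have "\<forall>w\<in>ball z r. poly (p - q) w = 0"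
    using pq unfolding P_def by simp
  then have "ball z r \<subseteq> {w. poly (p - q) w = 0}" by blast
  moreover have "infinite (ball z r)"
    using r uncountable_ball uncountable_infinite by blast
  ultimately have "infinite {w. poly (p - q) w = 0}"
    using finite_subset by blast
  then show "p = q"
    using poly_roots_finite[of "p - q"] by auto
qed

lemma rodrigues_poly_ex1:
  assumes "\<sigma> \<noteq> 0"
  shows "\<exists>!p. \<forall>U \<rho>. pearson_solution \<sigma> \<kappa> U \<rho> \<longrightarrow>
     (\<forall>z\<in>U. poly p z =
        1 / fact n * inverse (\<rho> z) * (deriv ^^ n) (\<lambda>w. poly \<sigma> w ^ n * \<rho> w) z)"
  by (rule ex1I, rule rodrigues_poly_aux(1)[OF assms], rule rodrigues_poly_aux(2)[OF assms],
      assumption, rule rodrigues_poly_aux(1)[OF assms])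

lemma rodrigues_poly_eq_aux:
  assumes "\<sigma> \<noteq> 0"
  shows "rodrigues_poly n \<sigma> \<kappa> = smult (1 / fact n) (rodrigues_aux \<sigma> \<kappa> n n)"
  unfolding rodrigues_poly_def
  by (rule the1_equality[OF rodrigues_poly_ex1 rodrigues_poly_aux(1)]) fact+

lemma poly_rodrigues_poly:
  assumes "\<sigma> \<noteq> 0" "pearson_solution \<sigma> \<kappa> U \<rho>" "z \<in> U"
  shows "poly (rodrigues_poly n \<sigma> \<kappa>) z =
         1 / fact n * inverse (\<rho> z) * (deriv ^^ n) (\<lambda>w. poly \<sigma> w ^ n * \<rho> w) z"
  using rodrigues_poly_aux(1)[OF assms(1)] assms by (auto simp: rodrigues_poly_eq_aux)

lemma degree_rodrigues_poly:
  assumes "\<sigma> \<noteq> 0" "degree \<sigma> \<le> 2" "degree \<kappa> \<le> 1"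
  shows "degree (rodrigues_poly n \<sigma> \<kappa>) \<le> n"
  using degree_rodrigues_aux[OF assms(2,3)] by (simp add: rodrigues_poly_eq_aux[OF assms(1)])

end

theory Submission
  imports Defs
begin

text \<open>
  The solution belonging to \<open>\<kappa> - n\<sigma>'\<close> is \<open>\<rho> \<sigma>\<^sup>-\<^sup>n\<close>, so the Rodrigues formula collapses to
  \<open>n! P\<^sub>n = \<sigma>\<^sup>n \<rho>\<^sup>(\<^sup>n\<^sup>) / \<rho>\<close>. The generating function is therefore the Taylor series of \<open>\<rho>\<close> at
  \<open>z\<close> with increment \<open>t\<sigma>(z)\<close>, and the raising relation is one differentiation of \<open>\<rho>\<^sup>(\<^sup>n\<^sup>)\<close>.
  The lowering relation follows from the raising relation by induction, and the composition of
  the two is the differential equation.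
\<close>

text \<open>This is \<sigma>^n \<rho>^(n) / \<rho>, generated without reference to a branch \<rho>.
  The term with \<open>of_nat n\<close> removes the contribution of differentiating
  \<sigma>^n.\<close>

fun pearson_deriv :: "'a::field_char_0 poly \<Rightarrow> 'a poly \<Rightarrow> nat \<Rightarrow> 'a poly" where
  "pearson_deriv \<sigma> \<kappa> 0 = 1"
| "pearson_deriv \<sigma> \<kappa> (Suc n) =
     \<sigma> * pderiv (pearson_deriv \<sigma> \<kappa> n) + (\<kappa> - smult (of_nat n) (pderiv \<sigma>)) * pearson_deriv \<sigma> \<kappa> n"

lemma higher_deriv_pearson_solution:
  assumes sol: "pearson_solution \<sigma> \<kappa> U \<rho>" and "z \<in> U"
  shows "poly \<sigma> z ^ n * (deriv ^^ n) \<rho> z = poly (pearson_deriv \<sigma> \<kappa> n) z * \<rho> z"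
  using assms(2)
proof (induction n arbitrary: z)
  case (Suc n)
  note S = sol[unfolded pearson_solution_def]
  let ?q = "pearson_deriv \<sigma> \<kappa> n"
  have "((deriv ^^ n) \<rho> has_field_derivative (deriv ^^ Suc n) \<rho> z) (at z)"
    using S Suc.prems holomorphic_derivI[OF holomorphic_higher_deriv] by auto
  then have "((\<lambda>w. poly (\<sigma> ^ n) w * (deriv ^^ n) \<rho> w) has_field_derivative
      poly (pderiv (\<sigma> ^ n)) z * (deriv ^^ n) \<rho> z + (deriv ^^ Suc n) \<rho> z * poly (\<sigma> ^ n) z) (at z)"
    by (intro DERIV_mult poly_DERIV)
  moreover have "((\<lambda>w. poly (\<sigma> ^ n) w * (deriv ^^ n) \<rho> w) has_field_derivative
      poly (pderiv ?q) z * \<rho> z + deriv \<rho> z * poly ?q z) (at z)"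
  proof (rule has_field_derivative_transform_within_open[of _ _ _ U])
    show "((\<lambda>w. poly ?q w * \<rho> w) has_field_derivative
      poly (pderiv ?q) z * \<rho> z + deriv \<rho> z * poly ?q z) (at z)"
      using S Suc.prems holomorphic_derivI by (intro DERIV_mult poly_DERIV) blast
  qed (use S Suc in auto)
  \<comment> \<open>Both expressions are derivatives of \<sigma>^n \<rho>^(n) at z: one by the
    product rule, one through the induction hypothesis on all of U. The factor \<sigma> lets
    \<sigma> \<rho>' be replaced by \<kappa> \<rho>.\<close>
  ultimately have "poly \<sigma> z * (poly (pderiv (\<sigma> ^ n)) z * (deriv ^^ n) \<rho> z
        + (deriv ^^ Suc n) \<rho> z * poly (\<sigma> ^ n) z) =
      poly \<sigma> z * (poly (pderiv ?q) z * \<rho> z + deriv \<rho> z * poly ?q z)"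
    by (rule arg_cong[OF DERIV_unique])
  also have "\<dots> = poly (\<sigma> * pderiv ?q) z * \<rho> z + (poly \<sigma> z * deriv \<rho> z) * poly ?q z"
    by (simp add: algebra_simps)
  also have "poly \<sigma> z * deriv \<rho> z = poly \<kappa> z * \<rho> z"
    using S Suc.prems by blast
  finally have "poly \<sigma> z ^ Suc n * (deriv ^^ Suc n) \<rho> z =
      poly (\<sigma> * pderiv ?q + \<kappa> * ?q) z * \<rho> z
      - poly (\<sigma> * pderiv (\<sigma> ^ n)) z * (deriv ^^ n) \<rho> z"
    by (simp add: algebra_simps)
  \<comment> \<open>The extra \<sigma> avoids the exponent n - 1, so n = 0 is covered too.\<close>
  also have "\<sigma> * pderiv (\<sigma> ^ n) = smult (of_nat n) (pderiv \<sigma>) * \<sigma> ^ n"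
    by (cases n) (simp, simp only: pderiv_power_Suc, simp add: mult_ac del: of_nat_Suc)
  also have "poly \<dots> z * (deriv ^^ n) \<rho> z =
      poly (smult (of_nat n) (pderiv \<sigma>)) z * (poly ?q z * \<rho> z)"
    using Suc.IH[OF Suc.prems] by simp
  finally show ?case
    by (simp add: algebra_simps)
qed simp

text \<open>The two recursions have the same coefficient: (n - k) \<sigma>' + \<kappa> - n \<sigma>'
  = \<kappa> - k \<sigma>', so n cancels. The bound on k keeps the subtraction of naturals from
  truncating.\<close>

lemma rodrigues_aux_kappa_minus:
  "k \<le> n \<Longrightarrow> rodrigues_aux \<sigma> (kappa_minus \<sigma> \<kappa> n) n k = pearson_deriv \<sigma> \<kappa> k"
proof (induction k)
  case (Suc k)
  then have "smult (of_nat (n - k)) (pderiv \<sigma>) + kappa_minus \<sigma> \<kappa> n =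
      \<kappa> - smult (of_nat k) (pderiv \<sigma>)"
    by (simp add: kappa_minus_def of_nat_diff smult_diff_left)
  with Suc show ?case by simp
qed simp

lemma rodrigues_poly_kappa_minus:
  assumes "\<sigma> \<noteq> 0"
  shows "rodrigues_poly n \<sigma> (kappa_minus \<sigma> \<kappa> n) = smult (1 / fact n) (pearson_deriv \<sigma> \<kappa> n)"
  by (simp add: rodrigues_poly_eq_aux[OF assms] rodrigues_aux_kappa_minus)

text \<open>Differentiating the recursion and inserting the induction hypothesis for the first
  derivative makes the remaining terms regroup into the recursion itself, one index lower.\<close>

lemma pderiv_pearson_deriv_Suc:
  fixes \<sigma> \<kappa> :: "'a::field_char_0 poly"
  assumes "pderiv (pderiv (pderiv \<sigma>)) = 0" and "pderiv (pderiv \<kappa>) = 0"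
  shows "pderiv (pearson_deriv \<sigma> \<kappa> (Suc n)) =
    smult (of_nat (Suc n)) ((pderiv \<kappa> - smult (of_nat n / 2) (pderiv (pderiv \<sigma>))) * pearson_deriv \<sigma> \<kappa> n)"
proof (induction n)
  case (Suc n)
  define h where "h = smult (1/2) (pderiv (pderiv \<sigma>))"
  define c where "c = pderiv \<kappa> - of_nat n * h"
  have h: "pderiv (pderiv \<sigma>) = 2 * h" "\<And>m. smult (of_nat m / 2) (pderiv (pderiv \<sigma>)) = of_nat m * h"
    by (simp_all add: h_def of_nat_poly numeral_poly)
  \<comment> \<open>Since c is constant, the induction hypothesis can be differentiated once more to
    give the second derivative.\<close>
  have c: "pderiv c = 0"
    using assms by (simp add: c_def h_def pderiv_diff pderiv_mult pderiv_smult)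
  let ?P = "pearson_deriv \<sigma> \<kappa>"
  let ?m = "of_nat (Suc n) :: 'a poly"
  have sm: "smult (of_nat m) p = of_nat m * p" for m and p :: "'a poly"
    by (simp add: of_nat_poly)
  have IH: "pderiv (?P (Suc n)) = ?m * (c * ?P n)"
    using Suc.IH unfolding h(2) c_def sm .
  have IH': "pderiv (pderiv (?P (Suc n))) = ?m * (c * pderiv (?P n))"
    unfolding IH by (simp add: pderiv_mult c del: of_nat_Suc)
  have step: "?P (Suc n) = \<sigma> * pderiv (?P n) + (\<kappa> - of_nat n * pderiv \<sigma>) * ?P n"
    by (simp add: sm)
  \<comment> \<open>The \<sigma>' from differentiating the leading factor \<sigma> turns \<kappa> -
    (n+1) \<sigma>' into \<kappa> - n \<sigma>', the coefficient in \<open>step\<close>.\<close>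
  have "pderiv (?P (Suc (Suc n))) =
      (pderiv \<kappa> - ?m * (2 * h)) * ?P (Suc n)
      + (\<kappa> - of_nat n * pderiv \<sigma>) * pderiv (?P (Suc n)) + \<sigma> * pderiv (pderiv (?P (Suc n)))"
    unfolding pearson_deriv.simps(2)[of \<sigma> \<kappa> "Suc n"] sm h(1)[symmetric]
    by (simp add: pderiv_add pderiv_diff pderiv_mult algebra_simps del: pearson_deriv.simps)
  also have "\<dots> = (pderiv \<kappa> - ?m * (2 * h)) * ?P (Suc n)
      + ?m * c * (\<sigma> * pderiv (?P n) + (\<kappa> - of_nat n * pderiv \<sigma>) * ?P n)"
    unfolding IH' unfolding IH by (simp add: algebra_simps del: of_nat_Suc pearson_deriv.simps)
  \<comment> \<open>With \<sigma>'' = 2h: \<kappa>' - 2(n+1)h + (n+1)(\<kappa>' - nh) =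
    (n+2)(\<kappa>' - (n+1)h).\<close>
  also have "\<dots> = of_nat (Suc (Suc n)) * ((pderiv \<kappa> - ?m * h) * ?P (Suc n))"
    unfolding step[symmetric] c_def by (simp add: algebra_simps del: pearson_deriv.simps)
  finally show ?case unfolding h(2) sm .
qed simp

lemma pearson_generating_function:
  assumes sol: "pearson_solution \<sigma> \<kappa> U \<rho>" and "r > 0" and "ball z r \<subseteq> U"
    and "z + t * poly \<sigma> z \<in> ball z r"
  shows "(\<lambda>n. t ^ n * (poly (pearson_deriv \<sigma> \<kappa> n) z / fact n))
    sums (\<rho> (z + t * poly \<sigma> z) / \<rho> z)"
proof -
  have z: "z \<in> U" using assms by auto
  have "\<rho> holomorphic_on ball z r"
    using sol assms(3) holomorphic_on_subset unfolding pearson_solution_def by blast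
  from sums_divide[OF holomorphic_power_series[OF this assms(4)], of "\<rho> z"]
  have "(\<lambda>n. (deriv ^^ n) \<rho> z / fact n * (t * poly \<sigma> z) ^ n / \<rho> z)
      sums (\<rho> (z + t * poly \<sigma> z) / \<rho> z)"
    by simp
  \<comment> \<open>The power \<sigma>(z)^n of the increment is what turns \<rho>^(n)(z) / \<rho>(z)
    into a polynomial value; \<rho>(z) is nonzero because solutions have no zeros on U.\<close>
  moreover have "(deriv ^^ n) \<rho> z / fact n * (t * poly \<sigma> z) ^ n / \<rho> z =
      t ^ n * (poly (pearson_deriv \<sigma> \<kappa> n) z / fact n)" for n
    using higher_deriv_pearson_solution[OF sol z, of n] pearson_solution_nonzero[OF sol z]
    by (simp add: power_mult_distrib field_simps)
  ultimately show ?thesis by simp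
qed

lemma omega_minus_kappa_minus:
  "omega_minus \<sigma> \<kappa> n =
     - smult (of_nat n + 1/2) (pderiv (kappa_minus \<sigma> \<kappa> n))
     - smult (of_nat n * (of_nat n + 1) / 2) (pderiv (pderiv \<sigma>))"
  by (rule poly_eqI)
    (simp add: omega_minus_def kappa_minus_def pderiv_diff pderiv_smult field_simps power2_eq_square)

lemma rodrigues_poly_raising:
  assumes "\<sigma> \<noteq> 0"
  shows "\<sigma> * pderiv (rodrigues_poly n \<sigma> (kappa_minus \<sigma> \<kappa> n))
      + kappa_minus \<sigma> \<kappa> n * rodrigues_poly n \<sigma> (kappa_minus \<sigma> \<kappa> n)
    = smult (of_nat (n + 1)) (rodrigues_poly (n + 1) \<sigma> (kappa_minus \<sigma> \<kappa> (n + 1)))"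
proof -
  \<comment> \<open>Up to this normalisation the claim is the defining recursion of
    \<open>pearson_deriv\<close>.\<close>
  have "(of_nat (Suc n) :: complex) * (1 / fact (Suc n)) = 1 / fact n"
    by (simp del: of_nat_Suc)
  then show ?thesis
    unfolding rodrigues_poly_kappa_minus[OF assms] Suc_eq_plus1[symmetric] smult_smult
    by (simp add: pderiv_smult smult_add_right kappa_minus_def del: of_nat_Suc fact_Suc)
qed

lemma rodrigues_poly_lowering:
  assumes "\<sigma> \<noteq> 0" and "pderiv (pderiv (pderiv \<sigma>)) = 0" and "pderiv (pderiv \<kappa>) = 0"
  shows "pderiv (rodrigues_poly (n + 1) \<sigma> (kappa_minus \<sigma> \<kappa> (n + 1)))
    = (smult (of_nat n / 2) (pderiv (pderiv \<sigma>)) + pderiv (kappa_minus \<sigma> \<kappa> n))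
      * rodrigues_poly n \<sigma> (kappa_minus \<sigma> \<kappa> n)"
proof -
  have f: "(1 / fact (Suc n)) * (of_nat (Suc n) :: complex) = 1 / fact n"
    by (simp del: of_nat_Suc)
  \<comment> \<open>The derivative of \<open>kappa_minus\<close> contributes -n \<sigma>'', which
    flips the sign of n \<sigma>''/2.\<close>
  have c: "smult (of_nat n / 2) (pderiv (pderiv \<sigma>)) + pderiv (kappa_minus \<sigma> \<kappa> n) =
      pderiv \<kappa> - smult (of_nat n / 2) (pderiv (pderiv \<sigma>))"
    by (rule poly_eqI) (simp add: kappa_minus_def pderiv_diff pderiv_smult field_simps)
  show ?thesis
    unfolding c rodrigues_poly_kappa_minus[OF assms(1)] Suc_eq_plus1[symmetric] pderiv_smult
      pderiv_pearson_deriv_Suc[OF assms(2,3)] smult_smult f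
    by simp
qed

lemma rodrigues_poly_hyp_op:
  assumes "\<sigma> \<noteq> 0" and "pderiv (pderiv (pderiv \<sigma>)) = 0" and "pderiv (pderiv \<kappa>) = 0"
  shows "hyp_op \<sigma> (kappa_minus \<sigma> \<kappa> n) (rodrigues_poly n \<sigma> (kappa_minus \<sigma> \<kappa> n))
    + omega_minus \<sigma> \<kappa> n * rodrigues_poly n \<sigma> (kappa_minus \<sigma> \<kappa> n) = 0"
proof -
  let ?k = "kappa_minus \<sigma> \<kappa> n"
  let ?c = "smult (of_nat n / 2) (pderiv (pderiv \<sigma>)) + pderiv ?k"
  define P where "P = rodrigues_poly n \<sigma> ?k"
  \<comment> \<open>Raising then lowering multiplies P by (n+1) \<open>?c\<close>; the value of
    \<omega> is exactly what cancels this after the correction by half of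
    \<open>pderiv ?k\<close>.\<close>
  have zero: "smult (of_nat (n + 1)) ?c - smult (1/2) (pderiv ?k) + omega_minus \<sigma> \<kappa> n = 0"
    unfolding omega_minus_kappa_minus
    by (rule poly_eqI) (simp add: field_simps)
  have "pderiv (\<sigma> * pderiv P + ?k * P) = smult (of_nat (n + 1)) (?c * P)"
    unfolding P_def rodrigues_poly_raising[OF assms(1)] pderiv_smult rodrigues_poly_lowering[OF assms] ..
  \<comment> \<open>Expanding the derivative yields the full term \<open>pderiv ?k * P\<close>,
    whereas \<open>hyp_op\<close> carries only half of it.\<close>
  moreover have "hyp_op \<sigma> ?k P =
      pderiv (\<sigma> * pderiv P + ?k * P) - smult (1/2) (pderiv ?k) * P"
  proof -
    define A where "A = smult (1/2) (pderiv ?k)"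
    have A: "pderiv ?k = A + A"
      by (simp add: A_def flip: smult_add_left)
    show ?thesis
      unfolding hyp_op_def pderiv_add pderiv_mult A_def[symmetric] unfolding A
      by (simp add: algebra_simps)
  qed
  ultimately have "hyp_op \<sigma> ?k P + omega_minus \<sigma> \<kappa> n * P =
      (smult (of_nat (n + 1)) ?c - smult (1/2) (pderiv ?k) + omega_minus \<sigma> \<kappa> n) * P"
    by (simp only: distrib_right left_diff_distrib mult_smult_left)
  then show ?thesis
    unfolding P_def[symmetric] zero by simp
qed

theorem proposition7p4:
  fixes \<sigma> \<kappa> :: "complex poly"
  assumes "\<sigma> \<noteq> 0" and "degree \<sigma> \<le> 2" and "degree \<kappa> \<le> 1"
  shows
    "(\<forall>n. omega_minus \<sigma> \<kappa> n =
            - smult (of_nat n + 1/2) (pderiv (kappa_minus \<sigma> \<kappa> n))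
            - smult (of_nat n * (of_nat n + 1) / 2) (pderiv (pderiv \<sigma>))) \<and>
     (\<forall>n. hyp_op \<sigma> (kappa_minus \<sigma> \<kappa> n) (rodrigues_poly n \<sigma> (kappa_minus \<sigma> \<kappa> n))
            + omega_minus \<sigma> \<kappa> n * rodrigues_poly n \<sigma> (kappa_minus \<sigma> \<kappa> n) = 0) \<and>
     (\<forall>n. \<sigma> * pderiv (rodrigues_poly n \<sigma> (kappa_minus \<sigma> \<kappa> n))
            + kappa_minus \<sigma> \<kappa> n * rodrigues_poly n \<sigma> (kappa_minus \<sigma> \<kappa> n)
          = smult (of_nat (n + 1)) (rodrigues_poly (n + 1) \<sigma> (kappa_minus \<sigma> \<kappa> (n + 1)))) \<and>
     (\<forall>n. pderiv (rodrigues_poly (n + 1) \<sigma> (kappa_minus \<sigma> \<kappa> (n + 1)))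
          = (smult (of_nat n / 2) (pderiv (pderiv \<sigma>)) + pderiv (kappa_minus \<sigma> \<kappa> n))
            * rodrigues_poly n \<sigma> (kappa_minus \<sigma> \<kappa> n)) \<and>
     (\<forall>U \<rho> z r t. pearson_solution \<sigma> \<kappa> U \<rho> \<and> r > 0 \<and> ball z r \<subseteq> U \<and>
          z + t * poly \<sigma> z \<in> ball z r \<longrightarrow>
          (\<lambda>n. t ^ n * poly (rodrigues_poly n \<sigma> (kappa_minus \<sigma> \<kappa> n)) z)
            sums (\<rho> (z + t * poly \<sigma> z) / \<rho> z))"
proof -
  \<comment> \<open>The degree bounds are used as constancy of \<sigma>'' and \<kappa>', the form
    the lowering relation takes.\<close>
  have \<sigma>: "pderiv (pderiv (pderiv \<sigma>)) = 0" and \<kappa>: "pderiv (pderiv \<kappa>) = 0"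
    using assms(2,3) by (simp_all add: pderiv_eq_0_iff degree_pderiv)
  have gen: "\<forall>U \<rho> z r t. pearson_solution \<sigma> \<kappa> U \<rho> \<and> r > 0 \<and> ball z r \<subseteq> U \<and>
        z + t * poly \<sigma> z \<in> ball z r \<longrightarrow>
      (\<lambda>n. t ^ n * poly (rodrigues_poly n \<sigma> (kappa_minus \<sigma> \<kappa> n)) z)
      sums (\<rho> (z + t * poly \<sigma> z) / \<rho> z)"
    unfolding rodrigues_poly_kappa_minus[OF assms(1)] poly_smult
    using pearson_generating_function[of \<sigma> \<kappa>] by (simp only: mult_1_left times_divide_eq_left) blast
  show ?thesis
    by (intro conjI; (rule gen | intro allI omega_minus_kappa_minus
        rodrigues_poly_hyp_op[OF assms(1) \<sigma> \<kappa>] rodrigues_poly_raising[OF assms(1)]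
        rodrigues_poly_lowering[OF assms(1) \<sigma> \<kappa>]))
qed

end
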